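(* Let $G=SU(2)$ and $K=SO(2)$. For all $z_1,z_2\in SU(2)$, $\mu_{z_1}\ast\mu_{z_2}\notin L^2(SU(2))$.
   Context: For $z\in G=SU(2)$, the orbital measure $\mu_z$ (for the symmetric space $SU(2)/SO(2)$) is the $K$-bi-invariant probability measure on $G$ defined by $\int_G f\,d\mu_z=\int_K\int_K f(k_1zk_2)\,dm_K(k_1)\,dm_K(k_2)$ for all continuous $f$ on $G$, where $K=SO(2)$ and $m_K$ is normalized Haar measure on $K$. Convolution is convolution of measures on $G$. For a measure $\mu$ on $G$, "$\mu\in L^2(G)$" means that $\mu$ is absolutely continuous with respect to Haar measure and its density is in $L^2(G)$. *)

theory Defs
  imports "HOL-Probability.Probability"
begin

definition conjugate_transpose :: "complex^'n^'m \<Rightarrow> complex^'m^'n" where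
  "conjugate_transpose A = (\<chi> i j. cnj (A $ j $ i))"

definition SU :: "(complex^'n^'n) set" where
  "SU = {A. conjugate_transpose A ** A = mat 1 \<and> A ** conjugate_transpose A = mat 1 \<and> det A = 1}"

(* The rotation group, embedded entrywise into the complex matrices so that it becomes
   a subgroup of SU. *)
definition SO :: "(complex^'n^'n) set" where
  "SO = (\<lambda>A. \<chi> i j. complex_of_real (A $ i $ j)) `
     {A :: real^'n^'n. rotation_matrix A}"

(* Normalized Haar measure on a compact matrix group H, with respect to the Borel sets of H.
   The group H is compact metrizable, so such a measure exists, is unique, and
   is automatically regular and right-invariant. *)
definition normalized_haar :: "(complex^'n^'n) set \<Rightarrow> (complex^'n^'n) measure \<Rightarrow> bool" where
  "normalized_haar H M \<longleftrightarrow>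
     sets M = sets (restrict_space borel H) \<and> prob_space M \<and>
     (\<forall>g\<in>H. distr M M (\<lambda>x. g ** x) = M)"

(* The distribution of k1 z k2 for independent Haar-distributed k1, k2; the lemma
   integral_orbital_measure below is the defining integral formula. *)
definition orbital_measure ::
  "(complex^'n^'n) measure \<Rightarrow> complex^'n^'n \<Rightarrow> (complex^'n^'n) measure" where
  "orbital_measure mK z =
     distr (mK \<Otimes>\<^sub>M mK) (restrict_space borel SU) (\<lambda>(k1, k2). k1 ** z ** k2)"

(* The library's convolution is for additive groups only. *)
definition mult_convolution ::
  "(complex^'n^'n) measure \<Rightarrow> (complex^'n^'n) measure \<Rightarrow> (complex^'n^'n) measure" where
  "mult_convolution M N =
     distr (M \<Otimes>\<^sub>M N) (restrict_space borel SU) (\<lambda>(x, y). x ** y)"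

definition has_L2_density :: "'a measure \<Rightarrow> 'a measure \<Rightarrow> bool" where
  "has_L2_density M N \<longleftrightarrow>
     sets N = sets M \<and> absolutely_continuous M N \<and>
     (\<integral>\<^sup>+ x. (RN_deriv M N x)\<^sup>2 \<partial>M) < \<infinity>"

lemma conjugate_transpose_mult:
  "conjugate_transpose (A ** B) = conjugate_transpose B ** conjugate_transpose A"
  by (simp add: conjugate_transpose_def matrix_matrix_mult_def vec_eq_iff mult.commute)

lemma SU_mult:
  fixes A B :: "complex^'n^'n"
  assumes A: "A \<in> SU" and B: "B \<in> SU"
  shows "A ** B \<in> SU"
proof -
  have "conjugate_transpose (A ** B) ** (A ** B)
      = conjugate_transpose B ** (conjugate_transpose A ** A) ** B"
    by (simp only: conjugate_transpose_mult matrix_mul_assoc)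
  moreover have "(A ** B) ** conjugate_transpose (A ** B)
      = A ** (B ** conjugate_transpose B) ** conjugate_transpose A"
    by (simp only: conjugate_transpose_mult matrix_mul_assoc)
  ultimately show ?thesis
    using A B by (simp add: SU_def det_mul)
qed

lemma det_of_real_matrix:
  "det (\<chi> i j. complex_of_real (A $ i $ j)) = complex_of_real (det (A :: real^'n^'n))"
  by (simp add: det_def)

lemma SO_subset_SU: "SO \<subseteq> SU"
proof
  fix B :: "complex^'n^'n" assume "B \<in> SO"
  then obtain A :: "real^'n^'n" where A: "orthogonal_matrix A" "det A = 1"
    and B: "B = (\<chi> i j. complex_of_real (A $ i $ j))" unfolding SO_def rotation_matrix_def by auto
  have 1: "(\<Sum>k\<in>UNIV. A $ k $ i * A $ k $ j) = (if i = j then 1 else 0)" for i j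
    using A(1) unfolding orthogonal_matrix_def
    by (simp add: matrix_matrix_mult_def transpose_def mat_def vec_eq_iff)
  have 2: "(\<Sum>k\<in>UNIV. A $ i $ k * A $ j $ k) = (if i = j then 1 else 0)" for i j
    using A(1) unfolding orthogonal_matrix_def
    by (simp add: matrix_matrix_mult_def transpose_def mat_def vec_eq_iff)
  have "conjugate_transpose B ** B = mat 1"
    using arg_cong[OF 1, of complex_of_real]
    by (simp add: B conjugate_transpose_def matrix_matrix_mult_def mat_def vec_eq_iff)
  moreover have "B ** conjugate_transpose B = mat 1"
    using arg_cong[OF 2, of complex_of_real]
    by (simp add: B conjugate_transpose_def matrix_matrix_mult_def mat_def vec_eq_iff)
  ultimately show "B \<in> SU"
    using A(2) by (simp add: SU_def B det_of_real_matrix)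
qed

lemma continuous_matrix_mult [continuous_intros]:
  fixes f g :: "'a::topological_space \<Rightarrow> complex^'n^'n"
  assumes "continuous_on S f" "continuous_on S g"
  shows "continuous_on S (\<lambda>x. f x ** g x)"
  unfolding matrix_matrix_mult_def by (intro continuous_intros assms)

lemma compact_SU: "compact (SU :: (complex^'n^'n) set)"
proof -
  have "closed {A :: complex^'n^'n. conjugate_transpose A ** A = mat 1 \<and>
      A ** conjugate_transpose A = mat 1 \<and> det A = 1}"
    unfolding conjugate_transpose_def det_def
    by (intro closed_Collect_conj closed_Collect_eq continuous_intros)
  moreover have "norm A \<le> real CARD('n) * real CARD('n)" if "A \<in> SU" for A :: "complex^'n^'n"
  proof -
    have entry: "norm (A $ i $ j) \<le> 1" for i j
    proof -
      have "(A ** conjugate_transpose A) $ i $ i = 1"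
        using that by (simp add: SU_def mat_def)
      then have "complex_of_real (\<Sum>k\<in>UNIV. (norm (A $ i $ k))\<^sup>2) = 1"
        by (simp only: matrix_matrix_mult_def conjugate_transpose_def vec_lambda_beta
            complex_norm_square of_real_sum)
      then have "(\<Sum>k\<in>UNIV. (norm (A $ i $ k))\<^sup>2) = 1"
        using of_real_eq_1_iff by blast
      moreover have "(norm (A $ i $ j))\<^sup>2 \<le> (\<Sum>k\<in>UNIV. (norm (A $ i $ k))\<^sup>2)"
        by (rule member_le_sum) auto
      ultimately show ?thesis
        by (simp add: abs_square_le_1)
    qed
    have "norm A \<le> (\<Sum>i\<in>UNIV. norm (A $ i))"
      by (simp add: norm_vec_def L2_set_le_sum)
    also have "\<dots> \<le> (\<Sum>i\<in>(UNIV::'n set). \<Sum>j\<in>(UNIV::'n set). 1)"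
    proof (rule sum_mono)
      fix i
      have "norm (A $ i) \<le> (\<Sum>j\<in>UNIV. norm (A $ i $ j))"
        by (simp add: norm_vec_def L2_set_le_sum)
      also have "\<dots> \<le> (\<Sum>j\<in>(UNIV::'n set). 1)"
        by (intro sum_mono entry)
      finally show "norm (A $ i) \<le> (\<Sum>j\<in>(UNIV::'n set). 1)" .
    qed
    finally show ?thesis by simp
  qed
  then have "bounded (SU :: (complex^'n^'n) set)"
    unfolding bounded_iff by blast
  ultimately show ?thesis
    unfolding compact_eq_bounded_closed by (simp add: SU_def)
qed

lemma measurable_mult_SU:
  fixes f g :: "'a \<Rightarrow> complex^'n^'n"
  assumes f: "f \<in> M \<rightarrow>\<^sub>M restrict_space borel SU"
    and g: "g \<in> M \<rightarrow>\<^sub>M restrict_space borel SU"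
  shows "(\<lambda>x. f x ** g x) \<in> M \<rightarrow>\<^sub>M restrict_space borel SU"
proof -
  have f': "f \<in> borel_measurable M" "f \<in> space M \<rightarrow> SU"
    using f by (simp_all add: measurable_restrict_space2_iff)
  have g': "g \<in> borel_measurable M" "g \<in> space M \<rightarrow> SU"
    using g by (simp_all add: measurable_restrict_space2_iff)
  have "continuous_on UNIV (\<lambda>p :: (complex^'n^'n) \<times> (complex^'n^'n). fst p ** snd p)"
    by (intro continuous_intros)
  then have "(\<lambda>p :: (complex^'n^'n) \<times> (complex^'n^'n). fst p ** snd p) \<in> borel_measurable borel"
    by (rule borel_measurable_continuous_onI)
  from measurable_compose[OF borel_measurable_Pair[OF f'(1) g'(1)] this]
  have "(\<lambda>x. f x ** g x) \<in> borel_measurable M"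
    by simp
  moreover have "(\<lambda>x. f x ** g x) \<in> space M \<rightarrow> SU"
    using f'(2) g'(2) by (blast intro: SU_mult)
  ultimately show ?thesis
    by (intro measurable_restrict_space2)
qed

lemma measurable_SO_SU:
  assumes "sets M = sets (restrict_space borel (SO :: (complex^'n^'n) set))"
  shows "(\<lambda>x. x) \<in> M \<rightarrow>\<^sub>M restrict_space borel SU"
proof -
  have "space M = SO"
    using sets_eq_imp_space_eq[OF assms] by (simp add: space_restrict_space)
  moreover have "(\<lambda>x. x) \<in> borel_measurable M"
    unfolding measurable_cong_sets[OF assms refl] by (rule measurable_restrict_space1) simp
  ultimately show ?thesis
    using SO_subset_SU by (intro measurable_restrict_space2) auto
qed

lemma measurable_orbital:
  assumes "normalized_haar SO mK" "z \<in> SU"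
  shows "(\<lambda>(k1, k2). k1 ** z ** k2 :: complex^'n^'n)
    \<in> mK \<Otimes>\<^sub>M mK \<rightarrow>\<^sub>M restrict_space borel SU"
proof -
  have id: "(\<lambda>x. x) \<in> mK \<rightarrow>\<^sub>M restrict_space borel SU"
    using assms(1) measurable_SO_SU unfolding normalized_haar_def by blast
  show ?thesis
    unfolding case_prod_beta
    using assms(2)
    by (intro measurable_mult_SU measurable_compose[OF _ id] measurable_const measurable_fst
        measurable_snd) (simp_all add: space_restrict_space)
qed

lemma prob_space_orbital_measure:
  assumes "normalized_haar SO mK" "z \<in> SU"
  shows "prob_space (orbital_measure mK z)"
proof -
  interpret K: prob_space mK using assms(1) by (simp add: normalized_haar_def)
  interpret KK: pair_prob_space mK mK ..
  show ?thesis unfolding orbital_measure_def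
    by (rule KK.prob_space_distr[OF measurable_orbital[OF assms]])
qed

lemma sets_orbital_measure [simp]:
  "sets (orbital_measure mK z) = sets (restrict_space borel SU)"
  by (simp add: orbital_measure_def)

lemma measurable_mult_convolution:
  assumes "sets M = sets (restrict_space borel (SU :: (complex^'n^'n) set))"
    and "sets N = sets (restrict_space borel (SU :: (complex^'n^'n) set))"
  shows "(\<lambda>(x, y). x ** y) \<in> M \<Otimes>\<^sub>M N \<rightarrow>\<^sub>M restrict_space borel SU"
proof -
  have "(\<lambda>x. x) \<in> M \<rightarrow>\<^sub>M restrict_space borel SU" "(\<lambda>x. x) \<in> N \<rightarrow>\<^sub>M restrict_space borel SU"
    using assms by (auto intro: measurable_ident_sets)
  then show ?thesis
    unfolding case_prod_beta
    by (intro measurable_mult_SU) (auto intro: measurable_compose[OF measurable_fst]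
        measurable_compose[OF measurable_snd])
qed

lemma integral_orbital_measure:
  fixes f :: "complex^'n^'n \<Rightarrow> complex"
  assumes mK: "normalized_haar SO mK" and z: "z \<in> SU" and f: "continuous_on SU f"
  shows "(\<integral>x. f x \<partial>orbital_measure mK z) = (\<integral>k1. \<integral>k2. f (k1 ** z ** k2) \<partial>mK \<partial>mK)"
proof -
  interpret K: prob_space mK using mK by (simp add: normalized_haar_def)
  interpret KK: pair_prob_space mK mK ..
  interpret O: prob_space "orbital_measure mK z" by (rule prob_space_orbital_measure[OF mK z])
  have f_meas: "f \<in> borel_measurable (restrict_space borel SU)"
    by (rule borel_measurable_continuous_on_restrict[OF f])
  obtain B where B: "\<And>x. x \<in> SU \<Longrightarrow> norm (f x) \<le> B"
    using compact_imp_bounded[OF compact_continuous_image[OF f compact_SU]]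
    unfolding bounded_iff by auto
  have "integrable (orbital_measure mK z) f"
    by (rule O.integrable_const_bound[of _ B])
      (use f_meas B in \<open>auto intro!: AE_I2 simp: orbital_measure_def space_restrict_space
        cong: measurable_cong_sets\<close>)
  then have "integrable (mK \<Otimes>\<^sub>M mK) (\<lambda>(k1, k2). f (k1 ** z ** k2))"
    unfolding orbital_measure_def
    by (subst (asm) integrable_distr_eq[OF measurable_orbital[OF mK z] f_meas])
      (simp add: case_prod_beta')
  from KK.integral_fst'[OF this] show ?thesis
    unfolding orbital_measure_def
    by (subst integral_distr[OF measurable_orbital[OF mK z] f_meas]) (simp add: case_prod_beta')
qed

end

theory Submission
  imports Defs
begin

text \<open>
  Identify \<open>SU(2)\<close> with the unit quaternions and write \<open>g = (P, Q)\<close>, where \<open>P\<close> is the component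
  of \<open>g\<close> in the span of \<open>SO(2)\<close> and \<open>Q\<close> the orthogonal one; then \<open>p = |P|\<^sup>2\<close> is \<open>SO(2)\<close>-bi-invariant.
  Under Haar measure \<open>p\<close> is uniform on \<open>[0,1]\<close>, so a window of width \<open>\<epsilon>\<close> has mass \<open>O(\<epsilon>)\<close>.
  Under the convolution of two orbital measures, \<open>p = b - c (sin s)\<^sup>2\<close> with \<open>s\<close> a uniform angle, where
  \<open>b\<close> is the maximum of \<open>p\<close>, so the window of width \<open>\<epsilon>\<close> at \<open>b\<close> has mass at least of order
  \<open>\<surd>\<epsilon>\<close>.  By Cauchy-Schwarz, an \<open>L\<^sup>2\<close> density would have square integral bounded below on
  windows that shrink to a null set.
\<close>

section \<open>Quaternion coordinates on SU(2) adapted to SO(2)\<close>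

text \<open>The entrywise real part of an element of \<open>SU\<close> is a real multiple of a
  rotation, hence determined by its first column. Packing that column into a complex number turns
  the rotation by \<open>t\<close> into \<open>cis t\<close>, so \<open>SO\<close> acts on the
  coordinates through phases.\<close>

definition SO_part :: "complex^2^2 \<Rightarrow> complex" where
  "SO_part A = Complex (Re (A $ 1 $ 1)) (Re (A $ 2 $ 1))"

definition SO_perp :: "complex^2^2 \<Rightarrow> complex" where
  "SO_perp A = Complex (Im (A $ 1 $ 1)) (Im (A $ 2 $ 1))"

text \<open>The inverse of \<open>A \<mapsto> (SO_part A, SO_perp A)\<close>: the first column has real parts \<open>x\<close> and
  imaginary parts \<open>y\<close>.\<close>

definition SU2_of :: "complex \<Rightarrow> complex \<Rightarrow> complex^2^2" where
  "SU2_of x y = vector [vector [Complex (Re x) (Re y), - cnj (Complex (Im x) (Im y))],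
                        vector [Complex (Im x) (Im y), cnj (Complex (Re x) (Re y))]]"

lemma SO_part_SU2_of [simp]: "SO_part (SU2_of x y) = x"
  by (simp add: SO_part_def SU2_of_def)

lemma SO_perp_SU2_of [simp]: "SO_perp (SU2_of x y) = y"
  by (simp add: SO_perp_def SU2_of_def)

lemma SU2_of_in_SU:
  assumes "(cmod x)\<^sup>2 + (cmod y)\<^sup>2 = 1"
  shows "SU2_of x y \<in> SU"
  using assms unfolding cmod_power2
  by (simp add: SU_def SU2_of_def conjugate_transpose_def matrix_matrix_mult_def det_2 vec_eq_iff
      forall_2 sum_2 mat_def complex_eq_iff power2_eq_square algebra_simps)

lemma SU2_second_column:
  fixes A :: "complex^2^2"
  assumes "A \<in> SU"
  shows "A $ 1 $ 2 = - cnj (A $ 2 $ 1)" "A $ 2 $ 2 = cnj (A $ 1 $ 1)"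
    "cnj (A $ 1 $ 1) * A $ 1 $ 1 + cnj (A $ 2 $ 1) * A $ 2 $ 1 = 1"
proof -
  define a b c d where abcd: "a = A $ 1 $ 1" "b = A $ 1 $ 2" "c = A $ 2 $ 1" "d = A $ 2 $ 2"
  have 1: "cnj a * a + cnj c * c = 1" and 2: "cnj a * b + cnj c * d = 0" and 3: "a * d - b * c = 1"
    using assms
    by (simp_all add: SU_def conjugate_transpose_def matrix_matrix_mult_def det_2 vec_eq_iff
      forall_2 sum_2 mat_def abcd)
  \<comment> \<open>Multiply 1 by \<open>b\<close>, replace \<open>cnj a * b\<close> by means of 2
    and apply 3; the formula for \<open>d\<close> arises in the same way from 1 multiplied by
    \<open>d\<close>.\<close>
  have "b = - cnj c" using 1 2 3 by algebra
  moreover have "d = cnj a" using 1 2 3 by algebra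
  ultimately show "A $ 1 $ 2 = - cnj (A $ 2 $ 1)" "A $ 2 $ 2 = cnj (A $ 1 $ 1)"
    "cnj (A $ 1 $ 1) * A $ 1 $ 1 + cnj (A $ 2 $ 1) * A $ 2 $ 1 = 1"
    using 1 by (simp_all add: abcd)
qed

text \<open>The first column of a unitary matrix is a unit vector.\<close>

lemma norm_SO_part_perp:
  assumes "A \<in> SU"
  shows "(cmod (SO_part A))\<^sup>2 + (cmod (SO_perp A))\<^sup>2 = 1"
  using arg_cong[OF SU2_second_column(3)[OF assms], of Re]
  unfolding cmod_power2 by (simp add: SO_part_def SO_perp_def power2_eq_square)

text \<open>Together with \<open>SO_perp_mult\<close> this is the Cayley-Dickson rule for
  multiplying quaternions written as pairs of complex numbers.\<close>

lemma SO_part_mult: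
  assumes "A \<in> SU" "B \<in> SU"
  shows "SO_part (A ** B) = SO_part A * SO_part B - SO_perp A * cnj (SO_perp B)"
  by (simp add: SO_part_def SO_perp_def matrix_matrix_mult_def sum_2 SU2_second_column[OF assms(1)]
      complex_eq_iff algebra_simps)

lemma SO_perp_mult:
  assumes "A \<in> SU" "B \<in> SU"
  shows "SO_perp (A ** B) = SO_part A * SO_perp B + SO_perp A * cnj (SO_part B)"
  by (simp add: SO_part_def SO_perp_def matrix_matrix_mult_def sum_2 SU2_second_column[OF assms(1)]
      complex_eq_iff algebra_simps)

lemma SO_perp_eq_0:
  assumes "k \<in> SO"
  shows "SO_perp k = 0"
  using assms by (auto simp: SO_def SO_perp_def complex_eq_iff)

lemma norm_SO_part_SO:
  assumes "k \<in> SO"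
  shows "cmod (SO_part k) = 1"
proof -
  have "k \<in> SU" using assms SO_subset_SU by blast
  then have "(cmod (SO_part k))\<^sup>2 = 1"
    using norm_SO_part_perp[of k] SO_perp_eq_0[OF assms] by simp
  then show ?thesis by (simp add: power2_eq_iff_nonneg[where y = 1, simplified])
qed

lemma SU2_of_in_SO:
  assumes "cmod x = 1"
  shows "SU2_of x 0 \<in> SO"
proof -
  define R :: "real^2^2" where "R = vector [vector [Re x, - Im x], vector [Im x, Re x]]"
  have "(Re x)\<^sup>2 + (Im x)\<^sup>2 = 1"
    using assms by (simp flip: cmod_power2)
  then have "rotation_matrix R"
    by (simp add: rotation_matrix_def orthogonal_matrix R_def transpose_def
        matrix_matrix_mult_def det_2 vec_eq_iff forall_2 sum_2 mat_def power2_eq_square algebra_simps)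
  moreover have "SU2_of x 0 = (\<chi> i j. complex_of_real (R $ i $ j))"
    by (simp add: vec_eq_iff forall_2 SU2_of_def R_def complex_eq_iff)
  ultimately show ?thesis by (auto simp: SO_def)
qed

lemma continuous_SO_part [continuous_intros]:
  assumes "continuous_on S f"
  shows "continuous_on S (\<lambda>x. SO_part (f x))"
  unfolding SO_part_def Complex_eq by (intro continuous_intros assms)

lemma continuous_SO_perp [continuous_intros]:
  assumes "continuous_on S f"
  shows "continuous_on S (\<lambda>x. SO_perp (f x))"
  unfolding SO_perp_def Complex_eq by (intro continuous_intros assms)

section \<open>Haar measure: invariance, orthogonality and moments\<close>

lemma measurable_restrict_borel_continuous:
  fixes f :: "complex^2^2 \<Rightarrow> 'a::topological_space"
  assumes "sets M = sets (restrict_space borel H)" and "continuous_on UNIV f"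
  shows "f \<in> borel_measurable M"
  unfolding measurable_cong_sets[OF assms(1) refl]
  by (intro measurable_restrict_space1 borel_measurable_continuous_onI assms)

lemma space_normalized_haar:
  assumes "normalized_haar H M"
  shows "space M = H"
  using assms sets_eq_imp_space_eq[of M "restrict_space borel H"]
  by (auto simp: normalized_haar_def space_restrict_space)

text \<open>The \<open>distr\<close> in \<open>normalized_haar\<close> can be evaluated through
  preimages only once the translation is known to be measurable. The set \<open>H\<close> is kept
  general to serve both \<open>SU\<close> and \<open>SO\<close>.\<close>

lemma normalized_haar_translate:
  fixes M :: "(complex^2^2) measure"
  assumes M: "normalized_haar H M" and g: "g \<in> H" and H: "\<And>x. x \<in> H \<Longrightarrow> g ** x \<in> H"
  shows "(\<lambda>x. g ** x) \<in> M \<rightarrow>\<^sub>M M"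
proof -
  have s: "sets M = sets (restrict_space borel H)" using M by (simp add: normalized_haar_def)
  show ?thesis
    unfolding measurable_cong_sets[OF refl s]
    by (rule measurable_restrict_space2)
      (auto intro!: measurable_restrict_borel_continuous[OF s] continuous_intros H
        simp: space_normalized_haar[OF M])
qed

lemma integral_left_invariant:
  fixes f :: "complex^2^2 \<Rightarrow> complex"
  assumes M: "normalized_haar SU M" and g: "g \<in> SU" and f: "continuous_on UNIV f"
  shows "(\<integral>x. f (g ** x) \<partial>M) = (\<integral>x. f x \<partial>M)"
proof -
  have "distr M M (\<lambda>x. g ** x) = M" and s: "sets M = sets (restrict_space borel SU)"
    using M g by (auto simp: normalized_haar_def)
  then have "(\<integral>x. f x \<partial>M) = (\<integral>x. f x \<partial>distr M M (\<lambda>x. g ** x))" by simp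
  also have "\<dots> = (\<integral>x. f (g ** x) \<partial>M)"
    by (intro integral_distr normalized_haar_translate[OF M g] SU_mult g
        measurable_restrict_borel_continuous[OF s f])
  finally show ?thesis by simp
qed

lemma integrable_normalized_haar:
  fixes f :: "complex^2^2 \<Rightarrow> complex"
  assumes M: "normalized_haar SU M" and f: "continuous_on UNIV f"
  shows "integrable M f"
proof -
  interpret prob_space M using M by (simp add: normalized_haar_def)
  have s: "sets M = sets (restrict_space borel SU)" using M by (simp add: normalized_haar_def)
  obtain B where B: "\<And>x. x \<in> SU \<Longrightarrow> norm (f x) \<le> B"
    using compact_imp_bounded[OF compact_continuous_image[OF continuous_on_subset[OF f] compact_SU]]
    unfolding bounded_iff by auto
  show ?thesis
    by (rule integrable_const_bound[of _ B])
      (auto intro!: AE_I2 B measurable_restrict_borel_continuous[OF s f]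
        simp: space_normalized_haar[OF M])
qed

text \<open>Translating by the rotation with angle \<open>t\<close> multiplies \<open>m k * cnj (m l)\<close> by
  \<open>cis (2 * (k - l) * t)\<close>, which is \<open>-1\<close> for a suitable \<open>t\<close>.\<close>

lemma haar_orthogonal:
  assumes M: "normalized_haar SU M" and "k \<le> n" "l \<le> n" "k \<noteq> l"
  defines "m \<equiv> \<lambda>j g. SO_part g ^ j * cnj (SO_perp g) ^ (n - j)"
  shows "(\<integral>g. m k g * cnj (m l g) \<partial>M) = 0"
proof -
  define t where "t = pi / (2 * (real k - real l))"
  have H: "SU2_of (cis t) 0 \<in> SU"
    by (rule SU2_of_in_SU) simp
  \<comment> \<open>The factor \<open>SO_part g\<close> picks up \<open>cis t\<close> and
    \<open>cnj (SO_perp g)\<close> picks up \<open>cis (- t)\<close>, so \<open>m j\<close> has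
    weight \<open>j - (n - j)\<close>.\<close>
  have trans: "m j (SU2_of (cis t) 0 ** g) = cis ((2 * real j - real n) * t) * m j g"
    if "j \<le> n" "g \<in> SU" for j g
    using that
    by (simp add: m_def SO_part_mult[OF H] SO_perp_mult[OF H] power_mult_distrib cis_cnj
       of_nat_diff Complex.DeMoivre cis_mult algebra_simps)
  let ?f = "\<lambda>g. m k g * cnj (m l g)"
  have c: "continuous_on UNIV ?f"
    unfolding m_def by (intro continuous_intros)
  have "?f (SU2_of (cis t) 0 ** g) = - ?f g" if "g \<in> SU" for g
  proof -
    have "?f (SU2_of (cis t) 0 ** g) = cis ((2 * real k - real n) * t) * cis (- ((2 * real l - real n) * t)) * ?f g"
      using assms(2,3) that by (simp add: trans cis_cnj)
    also have "cis ((2 * real k - real n) * t) * cis (- ((2 * real l - real n) * t))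
       = cis (2 * (real k - real l) * t)"
      by (simp add: cis_mult algebra_simps)
    also have "2 * (real k - real l) * t = pi"
      using \<open>k \<noteq> l\<close> by (simp add: t_def)
    finally show ?thesis by simp
  qed
  then have "(\<integral>g. ?f (SU2_of (cis t) 0 ** g) \<partial>M) = (\<integral>g. - ?f g \<partial>M)"
    by (intro Bochner_Integration.integral_cong) (auto simp: space_normalized_haar[OF M])
  \<comment> \<open>By invariance the left side is the integral of \<open>?f\<close> itself, which
    thus equals its own negative.\<close>
  then show ?thesis
    unfolding integral_left_invariant[OF M H c] by simp
qed

text \<open>A nonzero polynomial has finitely many roots, so agreement on a half-line suffices. It
  is applied with \<open>u\<close> the square of a real number.\<close>

lemma polynomial_coeffs_eq_nonneg:
  fixes a b :: "nat \<Rightarrow> real"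
  assumes "\<And>u. u \<ge> 0 \<Longrightarrow> (\<Sum>i\<le>n. a i * u ^ i) = (\<Sum>i\<le>n. b i * u ^ i)" and "i \<le> n"
  shows "a i = b i"
proof (rule ccontr)
  assume "a i \<noteq> b i"
  then have "finite {u. (\<Sum>i\<le>n. (a i - b i) * u ^ i) = 0}"
    unfolding polyfun_finite_roots using \<open>i \<le> n\<close> by auto
  moreover have "{0..} \<subseteq> {u. (\<Sum>i\<le>n. (a i - b i) * u ^ i) = 0}"
    using assms(1) by (auto simp: left_diff_distrib sum_subtractf)
  ultimately have "finite {0::real..}" by (rule rev_finite_subset)
  then show False using infinite_Ici by blast
qed


text \<open>A Parseval identity: after expanding the product, \<open>haar_orthogonal\<close> removes
  all terms off the diagonal.\<close>

lemma haar_orthogonal_sum: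
  fixes a :: "nat \<Rightarrow> complex"
  assumes M: "normalized_haar SU M"
  defines "m \<equiv> \<lambda>n j g. SO_part g ^ j * cnj (SO_perp g) ^ (n - j)"
  shows "(\<integral>g. (\<Sum>k\<le>n. a k * m n k g) * cnj (\<Sum>k\<le>n. a k * m n k g) \<partial>M)
       = (\<Sum>k\<le>n. a k * cnj (a k) * (\<integral>g. m n k g * cnj (m n k g) \<partial>M))"
proof -
  have int: "integrable M (\<lambda>g. m n k g * cnj (m n l g))" for k l
    unfolding m_def by (intro integrable_normalized_haar[OF M] continuous_intros)
  have "(\<integral>g. (\<Sum>k\<le>n. a k * m n k g) * cnj (\<Sum>k\<le>n. a k * m n k g) \<partial>M)
      = (\<integral>g. (\<Sum>k\<le>n. \<Sum>l\<le>n. a k * cnj (a l) * (m n k g * cnj (m n l g))) \<partial>M)"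
    by (simp add: sum_product mult_ac)
  also have "\<dots> = (\<Sum>k\<le>n. \<Sum>l\<le>n. a k * cnj (a l) * (\<integral>g. m n k g * cnj (m n l g) \<partial>M))"
    using int by (subst Bochner_Integration.integral_sum;
      auto intro!: Bochner_Integration.integrable_sum sum.cong
       simp: Bochner_Integration.integral_sum)
  also have "\<dots> = (\<Sum>k\<le>n. \<Sum>l\<le>n. if l = k then a k * cnj (a k) * (\<integral>g. m n k g * cnj (m n k g) \<partial>M) else 0)"
    using haar_orthogonal[OF M] by (intro sum.cong) (auto simp: m_def)
  finally show ?thesis by simp
qed

text \<open>By invariance, \<open>\<integral>|r P - cnj Q|\<^sup>2\<^sup>n = (1 + r\<^sup>2)\<^sup>n \<integral>|P|\<^sup>2\<^sup>n\<close> for all real \<open>r\<close>; the moments are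
  read off by comparing the coefficients of \<open>r\<^sup>2\<^sup>k\<close>.\<close>

lemma haar_power_moments:
  assumes M: "normalized_haar SU M" and "k \<le> n"
  shows "real (n choose k) * (\<integral>g. (cmod (SO_part g))\<^sup>2 ^ k * (cmod (SO_perp g))\<^sup>2 ^ (n - k) \<partial>M)
       = (\<integral>g. (cmod (SO_part g))\<^sup>2 ^ n \<partial>M)"
proof -
  define e where "e k = (\<integral>g. (cmod (SO_part g))\<^sup>2 ^ k * (cmod (SO_perp g))\<^sup>2 ^ (n - k) \<partial>M)" for k
  define m where "m j g = SO_part g ^ j * cnj (SO_perp g) ^ (n - j)" for j g
  define c where "c = (\<integral>g. (cmod (SO_part g))\<^sup>2 ^ n \<partial>M)"
  have sq: "x ^ j * cnj (x ^ j) = complex_of_real ((cmod x)\<^sup>2 ^ j)" for x j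
    by (simp only: of_real_power[of _ j] complex_norm_square complex_cnj_power power_mult_distrib)
  have e: "(\<integral>g. m k g * cnj (m k g) \<partial>M) = of_real (e k)" for k
  proof -
    have "m k g * cnj (m k g) = of_real ((cmod (SO_part g))\<^sup>2 ^ k * (cmod (SO_perp g))\<^sup>2 ^ (n - k))" for g
    proof -
      have "m k g * cnj (m k g) = (SO_part g ^ k * cnj (SO_part g ^ k)) * (SO_perp g ^ (n - k) * cnj (SO_perp g ^ (n - k)))"
        by (simp add: m_def)
      then show ?thesis unfolding sq by simp
    qed
    then show ?thesis by (simp only: e_def integral_complex_of_real)
  qed
  have "(\<Sum>k\<le>n. (real (n choose k))\<^sup>2 * e k * u ^ k) = (\<Sum>k\<le>n. c * real (n choose k) * u ^ k)"
    if "u \<ge> 0" for u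
  proof -
    define r where "r = sqrt u"
    have r: "r\<^sup>2 = u" using that by (simp add: r_def)
    define s where "s = sqrt (1 + u)"
    have s: "s > 0" "s\<^sup>2 = 1 + u" using that by (simp_all add: s_def)
    \<comment> \<open>Chosen so that the first coordinate of \<open>?h ** g\<close> is
      \<open>(r P - cnj Q) / s\<close>, with \<open>P\<close> and \<open>Q\<close> the coordinates
      of \<open>g\<close>; the division by \<open>s\<close> normalizes \<open>?h\<close>.\<close>
    let ?h = "SU2_of (r / s) (1 / s)"
    have h: "?h \<in> SU"
      using s r by (intro SU2_of_in_SU) (simp add: norm_divide power_divide flip: add_divide_distrib, use that in simp)
    have "complex_of_real c * of_real (1 + u) ^ n
        = of_real (1 + u) ^ n * (\<integral>g. SO_part g ^ n * cnj (SO_part g ^ n) \<partial>M)"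
      unfolding c_def sq integral_complex_of_real by simp
    also have "(\<integral>g. SO_part g ^ n * cnj (SO_part g ^ n) \<partial>M)
       = (\<integral>g. SO_part (?h ** g) ^ n * cnj (SO_part (?h ** g) ^ n) \<partial>M)"
      by (rule integral_left_invariant[OF M h, symmetric]) (intro continuous_intros)
    also have "of_real (1 + u) ^ n * \<dots> =
      (\<integral>g. of_real (1 + u) ^ n * (SO_part (?h ** g) ^ n * cnj (SO_part (?h ** g) ^ n)) \<partial>M)"
      by simp
    also have "\<dots> = (\<integral>g. (r * SO_part g - cnj (SO_perp g)) ^ n * cnj ((r * SO_part g - cnj (SO_perp g)) ^ n) \<partial>M)"
    proof (rule Bochner_Integration.integral_cong[OF refl])
      fix g assume "g \<in> space M"
      then have "g \<in> SU" by (simp add: space_normalized_haar[OF M])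
      then have "s * SO_part (?h ** g) = r * SO_part g - cnj (SO_perp g)"
        using s(1) unfolding SO_part_mult[OF h \<open>g \<in> SU\<close>] by (simp add: field_simps)
      then have "(r * SO_part g - cnj (SO_perp g)) ^ n * cnj ((r * SO_part g - cnj (SO_perp g)) ^ n)
        = (s * SO_part (?h ** g)) ^ n * cnj ((s * SO_part (?h ** g)) ^ n)" by simp
      also have "\<dots> = of_real (s\<^sup>2) ^ n * (SO_part (?h ** g) ^ n * cnj (SO_part (?h ** g) ^ n))"
        by (simp add: power_mult_distrib power2_eq_square)
      finally show "of_real (1 + u) ^ n * (SO_part (?h ** g) ^ n * cnj (SO_part (?h ** g) ^ n))
         = (r * SO_part g - cnj (SO_perp g)) ^ n * cnj ((r * SO_part g - cnj (SO_perp g)) ^ n)"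
        using s(2) by simp
    qed
    \<comment> \<open>The binomial theorem expresses the power through the orthogonal functions
      \<open>m k\<close>.\<close>
    also have "\<dots> = (\<integral>g. (\<Sum>k\<le>n. (of_nat (n choose k) * of_real r ^ k * (-1) ^ (n - k)) * m k g)
        * cnj (\<Sum>k\<le>n. (of_nat (n choose k) * of_real r ^ k * (-1) ^ (n - k)) * m k g) \<partial>M)"
    proof -
      have "(r * SO_part g - cnj (SO_perp g)) ^ n =
        (\<Sum>k\<le>n. (of_nat (n choose k) * of_real r ^ k * (-1) ^ (n - k)) * m k g)" for g
      proof -
        have "(r * SO_part g - cnj (SO_perp g)) ^ n = (r * SO_part g + (-1) * cnj (SO_perp g)) ^ n" by simp
        then show ?thesis
          unfolding binomial_ring by (simp only: m_def power_mult_distrib mult_ac)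
      qed
      then show ?thesis by simp
    qed
    \<comment> \<open>Only the diagonal survives; multiplying each coefficient by its conjugate
      removes the sign and turns \<open>r ^ k\<close> into \<open>u ^ k\<close>.\<close>
    also have "\<dots> = (\<Sum>k\<le>n. of_real ((real (n choose k))\<^sup>2 * e k * u ^ k))"
      unfolding m_def haar_orthogonal_sum[OF M] unfolding m_def[symmetric] e
    proof (rule sum.cong[OF refl])
      fix k
      have "cnj ((- 1) ^ (n - k)) * (- 1) ^ (n - k) = (1 :: complex)"
        by (simp flip: power_mult_distrib)
      moreover have "of_real (u ^ k) = complex_of_real r ^ k * of_real r ^ k"
        by (simp add: power2_eq_square flip: r power_mult_distrib)
      ultimately show "(of_nat (n choose k) * of_real r ^ k * (-1) ^ (n - k)) *
          cnj (of_nat (n choose k) * of_real r ^ k * (-1) ^ (n - k)) * of_real (e k)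
         = complex_of_real ((real (n choose k))\<^sup>2 * e k * u ^ k)"
        unfolding of_real_mult[of _ "u ^ k"] by (simp add: power2_eq_square)
    qed
    finally have "complex_of_real (c * (1 + u) ^ n) = of_real (\<Sum>k\<le>n. (real (n choose k))\<^sup>2 * e k * u ^ k)"
      by simp
    then have "c * (u + 1) ^ n = (\<Sum>k\<le>n. (real (n choose k))\<^sup>2 * e k * u ^ k)"
      by (simp only: of_real_eq_iff add.commute)
    then show ?thesis
      unfolding binomial_ring by (simp add: sum_distrib_left mult_ac)
  qed
  from polynomial_coeffs_eq_nonneg[OF this \<open>k \<le> n\<close>]
  have "(real (n choose k))\<^sup>2 * e k = c * real (n choose k)" .
  moreover have "real (n choose k) \<noteq> 0" using \<open>k \<le> n\<close> by simp
  ultimately have "real (n choose k) * e k = c"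
    by (simp add: power2_eq_square)
  then show ?thesis by (simp add: e_def c_def)
qed

section \<open>Bernstein polynomials and the Haar mass of a band\<close>

lemma integrable_real_normalized_haar:
  fixes f :: "complex^2^2 \<Rightarrow> real"
  assumes "normalized_haar SU M" and "continuous_on UNIV f"
  shows "integrable M f"
  using integrable_normalized_haar[OF assms(1), of "\<lambda>x. of_real (f x)"] assms(2)
  by (auto intro!: continuous_intros dest: integrable_Re)

lemma integrable_Bernstein:
  assumes "normalized_haar SU M"
  shows "integrable M (\<lambda>g. Bernstein n k ((cmod (SO_part g))\<^sup>2))"
  unfolding Bernstein_def by (intro integrable_real_normalized_haar[OF assms] continuous_intros)

text \<open>A discrete form of the uniform distribution of
  \<open>(cmod (SO_part g))\<^sup>2\<close>. By \<open>haar_power_moments\<close> the integral does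
  not depend on \<open>k\<close>, and the \<open>n + 1\<close> Bernstein polynomials of degree
  \<open>n\<close> sum to 1.\<close>

lemma haar_Bernstein:
  assumes M: "normalized_haar SU M" and "k \<le> n"
  shows "(\<integral>g. Bernstein n k ((cmod (SO_part g))\<^sup>2) \<partial>M) = 1 / (real n + 1)"
proof -
  interpret prob_space M using M by (simp add: normalized_haar_def)
  define c where "c = (\<integral>g. (cmod (SO_part g))\<^sup>2 ^ n \<partial>M)"
  have B: "(\<integral>g. Bernstein n k ((cmod (SO_part g))\<^sup>2) \<partial>M) = c" if "k \<le> n" for k
  proof -
    have "(\<integral>g. Bernstein n k ((cmod (SO_part g))\<^sup>2) \<partial>M)
      = (\<integral>g. real (n choose k) * ((cmod (SO_part g))\<^sup>2 ^ k * (cmod (SO_perp g))\<^sup>2 ^ (n - k)) \<partial>M)"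
    proof (rule Bochner_Integration.integral_cong[OF refl])
      fix g assume "g \<in> space M"
      then have "1 - (cmod (SO_part g))\<^sup>2 = (cmod (SO_perp g))\<^sup>2"
        using norm_SO_part_perp[of g] by (simp add: space_normalized_haar[OF M])
      then show "Bernstein n k ((cmod (SO_part g))\<^sup>2)
          = real (n choose k) * ((cmod (SO_part g))\<^sup>2 ^ k * (cmod (SO_perp g))\<^sup>2 ^ (n - k))"
        by (simp add: Bernstein_def)
    qed
    then show ?thesis using haar_power_moments[OF M that] by (simp add: c_def)
  qed
  have "1 = (\<integral>g. (\<Sum>k\<le>n. Bernstein n k ((cmod (SO_part g))\<^sup>2)) \<partial>M)"
    by (simp add: prob_space)
  also have "\<dots> = (\<Sum>k\<le>n. c)"
    unfolding Bochner_Integration.integral_sum[OF integrable_Bernstein[OF M]]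
    by (rule sum.cong) (simp_all add: B)
  finally have "c = 1 / (real n + 1)" by (simp add: field_simps)
  then show ?thesis using B[OF \<open>k \<le> n\<close>] by simp
qed

text \<open>For \<open>x\<close> in the unit interval, the numbers \<open>Bernstein n k x\<close>
  are the binomial distribution with \<open>n\<close> trials and success probability
  \<open>x\<close>; this is its variance.\<close>

lemma Bernstein_variance:
  "(\<Sum>k\<le>n. (real k - real n * x)\<^sup>2 * Bernstein n k x) = real n * x * (1 - x)"
proof -
  have "(\<Sum>k\<le>n. (real k - real n * x)\<^sup>2 * Bernstein n k x)
    = (\<Sum>k\<le>n. real k * (real k - 1) * Bernstein n k x + (1 - 2 * (real n * x)) * (real k * Bernstein n k x)
        + (real n * x)\<^sup>2 * Bernstein n k x)"
    by (intro sum.cong) (auto simp: power2_eq_square algebra_simps)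
  also have "\<dots> = real n * (real n - 1) * x\<^sup>2 + (1 - 2 * (real n * x)) * (real n * x) + (real n * x)\<^sup>2"
    by (simp add: sum.distrib flip: sum_distrib_left)
  finally show ?thesis by (simp add: power2_eq_square algebra_simps)
qed

lemma Bernstein_concentration:
  assumes "0 \<le> x" "x \<le> 1" "a > 0" "W \<subseteq> {..n}" "\<And>k. k \<le> n \<Longrightarrow> \<bar>real k - real n * x\<bar> \<le> a \<Longrightarrow> k \<in> W"
  shows "1 - real n / (4 * a\<^sup>2) \<le> (\<Sum>k\<in>W. Bernstein n k x)"
proof -
  have "a\<^sup>2 * (\<Sum>k\<in>{..n} - W. Bernstein n k x) \<le> (\<Sum>k\<in>{..n} - W. (real k - real n * x)\<^sup>2 * Bernstein n k x)"
    unfolding sum_distrib_left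
  proof (intro sum_mono mult_right_mono Bernstein_nonneg assms(1,2))
    fix k assume "k \<in> {..n} - W"
    then have "a \<le> \<bar>real k - real n * x\<bar>" using assms(5)[of k] by force
    then show "a\<^sup>2 \<le> (real k - real n * x)\<^sup>2"
      using \<open>a > 0\<close> by (simp add: abs_le_square_iff[symmetric])
  qed
  also have "\<dots> \<le> real n * x * (1 - x)"
    unfolding Bernstein_variance[symmetric]
    using assms(1,2) by (intro sum_mono2) (auto intro!: mult_nonneg_nonneg Bernstein_nonneg)
  also have "\<dots> \<le> real n * (1 / 4)"
  proof -
    have "x * (1 - x) \<le> 1 / 4"
      using zero_le_power2[of "x - 1 / 2"] by (simp add: power2_eq_square algebra_simps)
    then show ?thesis unfolding mult.assoc by (rule mult_left_mono) simp
  qed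
  finally have "(\<Sum>k\<in>{..n} - W. Bernstein n k x) \<le> real n / (4 * a\<^sup>2)"
    using \<open>a > 0\<close> by (simp add: field_simps)
  moreover have "(\<Sum>k\<in>{..n} - W. Bernstein n k x) = 1 - (\<Sum>k\<in>W. Bernstein n k x)"
    using assms(4) by (simp add: sum_diff)
  ultimately show ?thesis by simp
qed

lemma card_nat_near:
  assumes "t \<ge> 0"
  shows "real (card {k::nat. \<bar>real k - c\<bar> \<le> t}) \<le> 2 * t + 1"
proof -
  have "int ` {k::nat. \<bar>real k - c\<bar> \<le> t} \<subseteq> {\<lceil>c - t\<rceil>..\<lfloor>c + t\<rfloor>}"
    by (auto simp: ceiling_le_iff le_floor_iff)
  then have "card (int ` {k::nat. \<bar>real k - c\<bar> \<le> t}) \<le> card {\<lceil>c - t\<rceil>..\<lfloor>c + t\<rfloor>}"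
    by (intro card_mono) auto
  then have "card {k::nat. \<bar>real k - c\<bar> \<le> t} \<le> nat (\<lfloor>c + t\<rfloor> - \<lceil>c - t\<rceil> + 1)"
    by (simp add: card_image)
  then show ?thesis using assms by linarith
qed

text \<open>On the band, the Bernstein polynomials of degree \<open>N\<^sup>4\<close> with index in a window of
  \<open>O(N\<^sup>2)\<close> indices sum to at least \<open>3/4\<close>, and each of them has integral \<open>1 / (N\<^sup>4 + 1)\<close>.\<close>

lemma haar_band:
  fixes N :: nat
  assumes M: "normalized_haar SU M" and N: "N > 0"
  shows "measure M {g \<in> SU. \<bar>(cmod (SO_part g))\<^sup>2 - b\<bar> \<le> 16 / (real N)\<^sup>2} \<le> 50 / (real N)\<^sup>2"
proof -
  interpret prob_space M using M by (simp add: normalized_haar_def)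
  let ?p = "\<lambda>g. (cmod (SO_part g))\<^sup>2"
  let ?A = "{g \<in> SU. \<bar>?p g - b\<bar> \<le> 16 / (real N)\<^sup>2}"
  define n where "n = N ^ 4"
  have n: "real n = (real N)\<^sup>2 * (real N)\<^sup>2" by (simp add: n_def power2_eq_square power4_eq_xxxx)
  define W where "W = {k. \<bar>real k - real n * b\<bar> \<le> 17 * (real N)\<^sup>2} \<inter> {..n}"
  have c: "continuous_on UNIV ?p" by (intro continuous_intros)
  have [measurable]: "?p \<in> borel_measurable M"
    by (rule measurable_restrict_borel_continuous[OF _ c]) (use M in \<open>simp add: normalized_haar_def\<close>)
  have "?A = {g \<in> space M. \<bar>?p g - b\<bar> \<le> 16 / (real N)\<^sup>2}"
    by (simp add: space_normalized_haar[OF M])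
  then have A: "?A \<in> sets M" by simp
  have "(\<integral>g. indicator ?A g * (3 / 4 :: real) \<partial>M) \<le> (\<integral>g. (\<Sum>k\<in>W. Bernstein n k (?p g)) \<partial>M)"
  proof (rule integral_mono)
    show "integrable M (\<lambda>g. indicator ?A g * (3 / 4 :: real))"
      using A by (intro integrable_mult_left integrable_real_indicator) (auto simp: emeasure_eq_measure)
    show "integrable M (\<lambda>g. \<Sum>k\<in>W. Bernstein n k (?p g))"
      by (intro Bochner_Integration.integrable_sum integrable_Bernstein[OF M])
    fix g assume "g \<in> space M"
    then have p: "0 \<le> ?p g" "?p g \<le> 1"
      using norm_SO_part_perp[of g] zero_le_power2[of "cmod (SO_perp g)"]
      unfolding space_normalized_haar[OF M] by (simp, linarith)
    show "indicator ?A g * (3 / 4 :: real) \<le> (\<Sum>k\<in>W. Bernstein n k (?p g))"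
    proof (cases "g \<in> ?A")
      case True
      have "1 - real n / (4 * ((real N)\<^sup>2)\<^sup>2) \<le> (\<Sum>k\<in>W. Bernstein n k (?p g))"
      proof (rule Bernstein_concentration[OF p])
        fix k assume k: "k \<le> n" "\<bar>real k - real n * ?p g\<bar> \<le> (real N)\<^sup>2"
        have "\<bar>real n * ?p g - real n * b\<bar> = real n * \<bar>?p g - b\<bar>"
          by (simp add: abs_mult flip: right_diff_distrib)
        also have "\<dots> \<le> real n * (16 / (real N)\<^sup>2)"
          using True by (intro mult_left_mono) auto
        also have "\<dots> = 16 * (real N)\<^sup>2" using N by (simp add: n power2_eq_square)
        finally show "k \<in> W" using k by (simp add: W_def)
      qed (use N in \<open>auto simp: W_def\<close>)
      moreover have "real n / (4 * ((real N)\<^sup>2)\<^sup>2) = 1 / 4"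
        using N by (simp add: n power2_eq_square)
      ultimately have "1 - 1 / 4 \<le> (\<Sum>k\<in>W. Bernstein n k (?p g))" by (simp only:)
      then show ?thesis using True by (simp only: indicator_simps)
    next
      case False
      then show ?thesis using p by (auto intro!: sum_nonneg Bernstein_nonneg)
    qed
  qed
  also have "\<dots> = (\<Sum>k\<in>W. 1 / (real n + 1))"
    unfolding Bochner_Integration.integral_sum[OF integrable_Bernstein[OF M]]
    by (rule sum.cong[OF refl]) (simp add: haar_Bernstein[OF M] W_def)
  also have "\<dots> = real (card W) / (real n + 1)" by simp
  also have "\<dots> \<le> (35 * (real N)\<^sup>2) / (real N)\<^sup>2 / (real N)\<^sup>2"
  proof -
    have "real (card W) \<le> real (card {k. \<bar>real k - real n * b\<bar> \<le> 17 * (real N)\<^sup>2})"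
      unfolding W_def
    proof (intro of_nat_mono card_mono)
      have "{k. \<bar>real k - real n * b\<bar> \<le> 17 * (real N)\<^sup>2} \<subseteq> {..nat \<lceil>real n * b + 17 * (real N)\<^sup>2\<rceil>}"
        by auto linarith
      then show "finite {k. \<bar>real k - real n * b\<bar> \<le> 17 * (real N)\<^sup>2}" by (rule finite_subset) simp
    qed auto
    also have "\<dots> \<le> 2 * (17 * (real N)\<^sup>2) + 1" by (rule card_nat_near) simp
    also have "\<dots> \<le> 35 * (real N)\<^sup>2" using N by simp
    finally have "real (card W) / (real n + 1) \<le> 35 * (real N)\<^sup>2 / real n"
      by (rule frac_le[rotated]) (use N in \<open>simp_all add: n\<close>)
    then show ?thesis by (simp only: n divide_divide_eq_left)
  qed
  also have "\<dots> = 35 / (real N)\<^sup>2" using N by simp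
  finally have "measure M ?A * (3 / 4 :: real) \<le> 35 / (real N)\<^sup>2"
    using A by simp
  then show ?thesis using N by (simp add: field_simps)
qed


lemma norm_cis_combination_ge:
  obtains t0 where
    "\<And>t. (cmod x + cmod y)\<^sup>2 - 4 * (cmod x * cmod y) * (t - t0)\<^sup>2
      \<le> (cmod (x * cis t - y * cis (- t)))\<^sup>2"
proof -
  obtain a where a: "x = of_real (cmod x) * cis a"
    using rcis_cmod_Arg[of x] by (metis rcis_def)
  obtain b where b: "y = of_real (cmod y) * cis b"
    using rcis_cmod_Arg[of y] by (metis rcis_def)
  define t0 where "t0 = (b - a + pi) / 2"
  define c where "c = (a + b + pi) / 2"
  show ?thesis
  proof
    fix t
    define s where "s = t - t0"
    have "x * cis t = of_real (cmod x) * (cis a * cis t)" by (subst a) simp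
    also have "cis a * cis t = cis c * cis s"
    proof -
      have "a + t = c + s" unfolding c_def s_def t0_def by argo
      then show ?thesis by (simp add: cis_mult)
    qed
    finally have 1: "x * cis t = cis c * (of_real (cmod x) * cis s)" by simp
    have "y * cis (- t) = of_real (cmod y) * (cis b * cis (- t))" by (subst b) simp
    also have "cis b * cis (- t) = cis (c - s - pi)"
    proof -
      have "b + - t = c - s - pi" unfolding c_def s_def t0_def by argo
      then show ?thesis by (simp add: cis_mult)
    qed
    also have "\<dots> = - (cis c * cis (- s))"
      by (simp add: cis_mult complex_eq_iff cos_diff sin_diff)
    finally have 2: "y * cis (- t) = - (cis c * (of_real (cmod y) * cis (- s)))" by simp
    have "x * cis t - y * cis (- t) = cis c * (of_real (cmod x) * cis s + of_real (cmod y) * cis (- s))"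
      unfolding 1 2 by (simp add: algebra_simps)
    then have "(cmod (x * cis t - y * cis (- t)))\<^sup>2
        = (cmod (of_real (cmod x) * cis s + of_real (cmod y) * cis (- s)))\<^sup>2"
      by (simp add: norm_mult)
    also have "\<dots> = ((cmod x + cmod y) * cos s)\<^sup>2 + ((cmod x - cmod y) * sin s)\<^sup>2"
      unfolding cmod_power2 by (simp add: algebra_simps)
    also have "\<dots> = (cmod x + cmod y)\<^sup>2 - 4 * (cmod x * cmod y) * (sin s)\<^sup>2"
      unfolding power_mult_distrib cos_squared_eq by (simp add: power2_eq_square algebra_simps)
    also have "\<dots> \<ge> (cmod x + cmod y)\<^sup>2 - 4 * (cmod x * cmod y) * s\<^sup>2"
    proof -
      have "(sin s)\<^sup>2 \<le> s\<^sup>2" using abs_sin_x_le_abs_x[of s] by (simp add: abs_le_square_iff)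
      then show ?thesis by (simp add: mult_left_mono)
    qed
    finally show "(cmod x + cmod y)\<^sup>2 - 4 * (cmod x * cmod y) * (t - t0)\<^sup>2
      \<le> (cmod (x * cis t - y * cis (- t)))\<^sup>2" by (simp add: s_def)
  qed
qed

lemma SO_mult_SO:
  fixes k l :: "complex^2^2"
  assumes "k \<in> SO" "l \<in> SO"
  shows "k ** l \<in> SO"
proof -
  obtain A B :: "real^2^2" where A: "rotation_matrix A" and B: "rotation_matrix B"
    and kl: "k = (\<chi> i j. complex_of_real (A $ i $ j))" "l = (\<chi> i j. complex_of_real (B $ i $ j))"
    using assms by (auto simp: SO_def)
  have "rotation_matrix (A ** B)"
    using A B by (simp add: rotation_matrix_def orthogonal_matrix_mul det_mul)
  moreover have "k ** l = (\<chi> i j. complex_of_real ((A ** B) $ i $ j))"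
    by (simp add: kl matrix_matrix_mult_def vec_eq_iff)
  ultimately show ?thesis by (auto simp: SO_def)
qed

lemma SO_part_mult_SO:
  assumes "k \<in> SO" "g \<in> SU"
  shows "SO_part (k ** g) = SO_part k * SO_part g" "SO_perp (k ** g) = SO_part k * SO_perp g"
    "SO_part (g ** k) = SO_part g * SO_part k" "SO_perp (g ** k) = SO_perp g * cnj (SO_part k)"
proof -
  have "k \<in> SU" using assms(1) SO_subset_SU by blast
  then show "SO_part (k ** g) = SO_part k * SO_part g" "SO_perp (k ** g) = SO_part k * SO_perp g"
    "SO_part (g ** k) = SO_part g * SO_part k" "SO_perp (g ** k) = SO_perp g * cnj (SO_part k)"
    using assms(2) by (simp_all add: SO_part_mult SO_perp_mult SO_perp_eq_0[OF assms(1)])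
qed

text \<open>The maximum is attained at some angle \<open>t0\<close>, and \<open>N\<close> translates of the arc of radius
  \<open>\<pi> / N\<close> around \<open>t0\<close> cover \<open>SO\<close>.\<close>

lemma SO_haar_near_max:
  fixes N :: nat
  assumes K: "normalized_haar SO mK" and N: "N > 0" and xy: "cmod x * cmod y \<le> 1 / 4"
  shows "1 / real N \<le> measure mK {k \<in> SO.
    \<bar>(cmod (x * SO_part k - y * cnj (SO_part k)))\<^sup>2 - (cmod x + cmod y)\<^sup>2\<bar> \<le> 16 / (real N)\<^sup>2}"
proof -
  interpret prob_space mK using K by (simp add: normalized_haar_def)
  note s = K[unfolded normalized_haar_def, THEN conjunct1]
  let ?f = "\<lambda>k. (cmod (x * SO_part k - y * cnj (SO_part k)))\<^sup>2"
  let ?S = "{k \<in> SO. \<bar>?f k - (cmod x + cmod y)\<^sup>2\<bar> \<le> 16 / (real N)\<^sup>2}"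
  have [measurable]: "?f \<in> borel_measurable mK"
    by (rule measurable_restrict_borel_continuous[OF s]) (intro continuous_intros)
  have "?S = {k \<in> space mK. \<bar>?f k - (cmod x + cmod y)\<^sup>2\<bar> \<le> 16 / (real N)\<^sup>2}"
    by (simp add: space_normalized_haar[OF K])
  then have S: "?S \<in> sets mK" by simp
  obtain t0 where t0: "\<And>t. (cmod x + cmod y)\<^sup>2 - 4 * (cmod x * cmod y) * (t - t0)\<^sup>2
      \<le> (cmod (x * cis t - y * cis (- t)))\<^sup>2" using norm_cis_combination_ge by blast
  define R :: "nat \<Rightarrow> complex^2^2" where "R j = SU2_of (cis (- (2 * pi * real j / real N))) 0" for j
  have R: "R j \<in> SO" for j unfolding R_def by (rule SU2_of_in_SO) simp
  let ?T = "\<lambda>j. (\<lambda>k. R j ** k) -` ?S \<inter> space mK"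
  have T: "?T j \<in> sets mK" "measure mK (?T j) = measure mK ?S" for j
  proof -
    have m: "(\<lambda>k. R j ** k) \<in> mK \<rightarrow>\<^sub>M mK"
      by (rule normalized_haar_translate[OF K R]) (rule SO_mult_SO[OF R])
    show "?T j \<in> sets mK" using measurable_sets[OF m S] .
    have "distr mK mK (\<lambda>k. R j ** k) = mK" using K R by (simp add: normalized_haar_def)
    then show "measure mK (?T j) = measure mK ?S"
      using measure_distr[OF m S] by simp
  qed
  have "space mK \<subseteq> (\<Union>j<N. ?T j)"
  proof
    fix k assume "k \<in> space mK"
    then have k: "k \<in> SO" by (simp add: space_normalized_haar[OF K])
    then have kSU: "k \<in> SU" using SO_subset_SU by blast
    obtain t where t: "SO_part k = cis t"
      using norm_SO_part_SO[OF k] rcis_cmod_Arg[of "SO_part k"] by (metis rcis_def mult_1 of_real_1)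
    define m where "m = round ((t - t0) * real N / (2 * pi))"
    define q where "q = m div int N"
    define j where "j = nat (m mod int N)"
    have j: "j < N" and mj: "m = q * int N + int j" using N by (auto simp: j_def q_def nat_less_iff)
    define u where "u = t - 2 * pi * real_of_int m / real N"
    have "SO_part (R j ** k) = cis (- (2 * pi * real j / real N)) * cis t"
      by (simp add: SO_part_mult_SO(1)[OF R kSU] t) (simp add: R_def)
    also have "\<dots> = cis u * cis (2 * pi * real_of_int q)"
      using N by (simp add: cis_mult u_def mj field_simps)
    also have "cis (2 * pi * real_of_int q) = 1"
      by (simp add: cis_multiple_2pi)
    finally have u: "SO_part (R j ** k) = cis u" by simp
    have "\<bar>u - t0\<bar> \<le> pi / real N"
    proof -
      have "\<bar>of_int m - (t - t0) * real N / (2 * pi)\<bar> \<le> 1 / 2"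
        unfolding m_def by (rule of_int_round_abs_le)
      then have "(2 * pi / real N) * \<bar>of_int m - (t - t0) * real N / (2 * pi)\<bar> \<le> (2 * pi / real N) * (1 / 2)"
        by (intro mult_left_mono) auto
      also have "(2 * pi / real N) * \<bar>of_int m - (t - t0) * real N / (2 * pi)\<bar> =
          \<bar>(2 * pi / real N) * (of_int m - (t - t0) * real N / (2 * pi))\<bar>" by (simp add: abs_mult)
      also have "(2 * pi / real N) * (of_int m - (t - t0) * real N / (2 * pi)) = - (u - t0)"
        using N by (simp add: u_def field_simps)
      finally show ?thesis by simp
    qed
    also have "\<dots> \<le> 4 / real N" using pi_less_4 by (intro divide_right_mono) auto
    finally have "(u - t0)\<^sup>2 \<le> (4 / real N)\<^sup>2"
      unfolding abs_le_square_iff[symmetric] by simp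
    then have "4 * (cmod x * cmod y) * (u - t0)\<^sup>2 \<le> 1 * (4 / real N)\<^sup>2"
      using xy by (intro mult_mono) auto
    then have "(cmod x + cmod y)\<^sup>2 - 16 / (real N)\<^sup>2 \<le> ?f (R j ** k)"
      using t0[of u] by (simp add: u cis_cnj power_divide)
    moreover have "?f (R j ** k) \<le> (cmod x + cmod y)\<^sup>2"
      using norm_triangle_ineq4[of "x * cis u" "y * cis (- u)"]
      by (intro power_mono) (simp_all add: u cis_cnj norm_mult)
    moreover have "0 \<le> 16 / (real N)\<^sup>2" by simp
    ultimately have "\<bar>?f (R j ** k) - (cmod x + cmod y)\<^sup>2\<bar> \<le> 16 / (real N)\<^sup>2" by linarith
    then have "R j ** k \<in> ?S" using SO_mult_SO[OF R k] by blast
    then show "k \<in> (\<Union>j<N. ?T j)" using j \<open>k \<in> space mK\<close> by auto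
  qed
  then have "1 \<le> measure mK (\<Union>j<N. ?T j)"
    unfolding prob_space[symmetric]
    by (rule finite_measure_mono) (intro sets.finite_UN T(1) finite_lessThan)
  also have "\<dots> \<le> (\<Sum>j<N. measure mK (?T j))"
    using T(1) by (intro finite_measure_subadditive_finite) auto
  also have "\<dots> = real N * measure mK ?S" using T(2) by simp
  finally show ?thesis using N by (simp add: field_simps)
qed

lemma mult_le_quarter:
  fixes a b c d :: real
  assumes "a\<^sup>2 + b\<^sup>2 = 1" "c\<^sup>2 + d\<^sup>2 = 1"
  shows "(a * c) * (b * d) \<le> 1 / 4"
proof -
  have "\<bar>a * b\<bar> \<le> 1 / 2" "\<bar>c * d\<bar> \<le> 1 / 2"
    using sum_squares_bound[of "\<bar>a\<bar>" "\<bar>b\<bar>"] sum_squares_bound[of "\<bar>c\<bar>" "\<bar>d\<bar>"] assms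
    by (auto simp: abs_mult)
  then have "\<bar>a * b\<bar> * \<bar>c * d\<bar> \<le> (1 / 2) * (1 / 2)"
    by (intro mult_mono) auto
  then have "\<bar>(a * c) * (b * d)\<bar> \<le> 1 / 4" by (simp add: abs_mult mult_ac)
  then show ?thesis by linarith
qed

lemma emeasure_orbital_measure_ge:
  assumes K: "normalized_haar SO mK" and z: "z \<in> SU" and S: "S \<in> sets (restrict_space borel SU)"
    and le: "\<And>k. k \<in> SO \<Longrightarrow> c \<le> emeasure mK {k' \<in> SO. k' ** z ** k \<in> S}"
  shows "c \<le> emeasure (orbital_measure mK z) S"
proof -
  interpret K: prob_space mK using K by (simp add: normalized_haar_def)
  interpret KK: pair_prob_space mK mK ..
  let ?T = "(\<lambda>(k1, k2). k1 ** z ** k2) -` S \<inter> space (mK \<Otimes>\<^sub>M mK)"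
  have T: "?T \<in> sets (mK \<Otimes>\<^sub>M mK)"
    by (rule measurable_sets[OF measurable_orbital[OF K z] S])
  have "c = (\<integral>\<^sup>+k. c \<partial>mK)" by (simp add: K.emeasure_space_1)
  also have "\<dots> \<le> (\<integral>\<^sup>+k. emeasure mK ((\<lambda>x. (x, k)) -` ?T) \<partial>mK)"
  proof (rule nn_integral_mono)
    fix k assume "k \<in> space mK"
    then have k: "k \<in> SO" by (simp add: space_normalized_haar[OF K])
    then have "(\<lambda>x. (x, k)) -` ?T = {k' \<in> SO. k' ** z ** k \<in> S}"
      by (auto simp: space_pair_measure space_normalized_haar[OF K])
    then show "c \<le> emeasure mK ((\<lambda>x. (x, k)) -` ?T)" using le[OF k] by simp
  qed
  also have "\<dots> = emeasure (orbital_measure mK z) S"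
    unfolding orbital_measure_def
    by (simp add: emeasure_distr[OF measurable_orbital[OF K z] S] KK.emeasure_pair_measure_alt2[OF T])
  finally show ?thesis .
qed

lemma orbital_convolution_near_max:
  fixes N :: nat and z1 z2 :: "complex^2^2"
  assumes K: "normalized_haar SO mK" and z: "z1 \<in> SU" "z2 \<in> SU" and N: "N > 0"
  defines "b \<equiv> (cmod (SO_part z1) * cmod (SO_part z2) + cmod (SO_perp z1) * cmod (SO_perp z2))\<^sup>2"
  shows "ennreal (1 / real N) \<le> emeasure (mult_convolution (orbital_measure mK z1) (orbital_measure mK z2))
    {g \<in> SU. \<bar>(cmod (SO_part g))\<^sup>2 - b\<bar> \<le> 16 / (real N)\<^sup>2}"
proof -
  interpret K: prob_space mK using K by (simp add: normalized_haar_def)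
  interpret KK: pair_prob_space mK mK ..
  interpret O2: prob_space "orbital_measure mK z2" by (rule prob_space_orbital_measure[OF K z(2)])
  let ?X = "{g \<in> SU. \<bar>(cmod (SO_part g))\<^sup>2 - b\<bar> \<le> 16 / (real N)\<^sup>2}"
  let ?Y = "\<lambda>x. {y \<in> SU. x ** y \<in> ?X}"
  have X: "?X \<in> sets (restrict_space borel SU)"
  proof -
    have [measurable]: "(\<lambda>g. (cmod (SO_part g))\<^sup>2) \<in> borel_measurable (restrict_space borel SU)"
      by (rule measurable_restrict_borel_continuous[OF refl]) (intro continuous_intros)
    have "?X = {g \<in> space (restrict_space borel SU). \<bar>(cmod (SO_part g))\<^sup>2 - b\<bar> \<le> 16 / (real N)\<^sup>2}"
      by (simp add: space_restrict_space)
    then show ?thesis by simp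
  qed
  let ?T = "(\<lambda>(x, y). x ** y) -` ?X \<inter> space (orbital_measure mK z1 \<Otimes>\<^sub>M orbital_measure mK z2)"
  have meas: "(\<lambda>(x, y). x ** y) \<in> orbital_measure mK z1 \<Otimes>\<^sub>M orbital_measure mK z2
      \<rightarrow>\<^sub>M restrict_space borel SU"
    by (rule measurable_mult_convolution) simp_all
  have T: "?T \<in> sets (orbital_measure mK z1 \<Otimes>\<^sub>M orbital_measure mK z2)"
    by (rule measurable_sets[OF meas X])
  have space_O: "space (orbital_measure mK z) = SU" for z
    by (simp add: orbital_measure_def space_restrict_space)
  have slice: "Pair x -` ?T = ?Y x" if "x \<in> SU" for x
    using that by (auto simp: space_pair_measure space_O)
  have Y: "?Y x \<in> sets (restrict_space borel SU)" if "x \<in> SU" for x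
    using sets_Pair1[OF T, of x] slice[OF that] by simp
  have ge: "ennreal (1 / real N) \<le> emeasure (orbital_measure mK z2) (?Y (k1 ** z1 ** k2))"
    if k: "k1 \<in> SO" "k2 \<in> SO" for k1 k2
  proof (rule emeasure_orbital_measure_ge[OF K z(2)])
    let ?a = "k1 ** z1 ** k2"
    have k1z: "k1 ** z1 \<in> SU" and a: "?a \<in> SU"
      using k z SO_subset_SU by (auto intro!: SU_mult)
    have na: "cmod (SO_part ?a) = cmod (SO_part z1)" "cmod (SO_perp ?a) = cmod (SO_perp z1)"
      using k by (simp_all add: SO_part_mult_SO k1z z norm_mult norm_SO_part_SO)
    show "?Y ?a \<in> sets (restrict_space borel SU)" by (rule Y[OF a])
    fix l :: "complex^2^2" assume l: "l \<in> SO"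
    have zl: "z2 ** l \<in> SU" using l z SO_subset_SU by (auto intro!: SU_mult)
    have nl: "cmod (SO_part (z2 ** l)) = cmod (SO_part z2)" "cmod (SO_perp (z2 ** l)) = cmod (SO_perp z2)"
      using l by (simp_all add: SO_part_mult_SO z norm_mult norm_SO_part_SO)
    let ?x = "SO_part ?a * SO_part (z2 ** l)" and ?y = "SO_perp ?a * cnj (SO_perp (z2 ** l))"
    have "cmod ?x * cmod ?y \<le> 1 / 4"
      unfolding norm_mult complex_mod_cnj na nl
      by (rule mult_le_quarter[OF norm_SO_part_perp[OF z(1)] norm_SO_part_perp[OF z(2)]])
    from SO_haar_near_max[OF K N this]
    have "1 / real N \<le> measure mK {k \<in> SO.
      \<bar>(cmod (?x * SO_part k - ?y * cnj (SO_part k)))\<^sup>2 - (cmod ?x + cmod ?y)\<^sup>2\<bar> \<le> 16 / (real N)\<^sup>2}" .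
    also have "{k \<in> SO.
      \<bar>(cmod (?x * SO_part k - ?y * cnj (SO_part k)))\<^sup>2 - (cmod ?x + cmod ?y)\<^sup>2\<bar> \<le> 16 / (real N)\<^sup>2}
      = {k \<in> SO. k ** z2 ** l \<in> ?Y ?a}"
    proof (rule Collect_cong, rule conj_cong[OF refl])
      fix k :: "complex^2^2" assume kk: "k \<in> SO"
      have kzl: "k ** (z2 ** l) \<in> SU" using kk zl SO_subset_SU by (auto intro!: SU_mult)
      have "SO_part (?a ** (k ** z2 ** l)) = ?x * SO_part k - ?y * cnj (SO_part k)"
        unfolding matrix_mul_assoc[of k z2 l, symmetric] SO_part_mult[OF a kzl] SO_part_mult_SO(1,2)[OF kk zl]
        by simp
      moreover have "(cmod ?x + cmod ?y)\<^sup>2 = b"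
        by (simp only: b_def norm_mult complex_mod_cnj na nl)
      moreover have "?a ** (k ** z2 ** l) \<in> SU" "k ** z2 ** l \<in> SU"
        using SU_mult[OF a kzl] kzl by (simp_all only: matrix_mul_assoc[of k z2 l])
      ultimately show "(\<bar>(cmod (?x * SO_part k - ?y * cnj (SO_part k)))\<^sup>2 - (cmod ?x + cmod ?y)\<^sup>2\<bar>
          \<le> 16 / (real N)\<^sup>2) \<longleftrightarrow> k ** z2 ** l \<in> ?Y ?a" by simp
    qed
    finally show "ennreal (1 / real N) \<le> emeasure mK {k \<in> SO. k ** z2 ** l \<in> ?Y ?a}"
      by (simp add: K.emeasure_eq_measure ennreal_leI)
  qed
  let ?F = "\<lambda>x. emeasure (orbital_measure mK z2) (Pair x -` ?T)"
  have F: "?F \<in> borel_measurable (orbital_measure mK z1)"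
    by (rule O2.measurable_emeasure_Pair[OF T])
  have "ennreal (1 / real N) = (\<integral>\<^sup>+p. ennreal (1 / real N) \<partial>(mK \<Otimes>\<^sub>M mK))"
    by (simp add: KK.emeasure_space_1)
  also have "\<dots> \<le> (\<integral>\<^sup>+p. ?F (case p of (k1, k2) \<Rightarrow> k1 ** z1 ** k2) \<partial>(mK \<Otimes>\<^sub>M mK))"
  proof (rule nn_integral_mono)
    fix p assume "p \<in> space (mK \<Otimes>\<^sub>M mK)"
    then obtain k1 k2 where p: "p = (k1, k2)" "k1 \<in> SO" "k2 \<in> SO"
      by (auto simp: space_pair_measure space_normalized_haar[OF K])
    then have "k1 ** z1 ** k2 \<in> SU" using z SO_subset_SU by (auto intro!: SU_mult)
    then show "ennreal (1 / real N) \<le> ?F (case p of (k1, k2) \<Rightarrow> k1 ** z1 ** k2)"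
      using ge[OF p(2,3)] by (simp only: p(1) prod.case slice)
  qed
  also have "\<dots> = (\<integral>\<^sup>+x. ?F x \<partial>orbital_measure mK z1)"
    unfolding orbital_measure_def[of mK z1]
    by (rule nn_integral_distr[OF measurable_orbital[OF K z(1)], symmetric])
      (use F in \<open>simp add: orbital_measure_def\<close>)
  also have "\<dots> = emeasure (mult_convolution (orbital_measure mK z1) (orbital_measure mK z2)) ?X"
    unfolding mult_convolution_def emeasure_distr[OF meas X]
    by (rule O2.emeasure_pair_measure_alt[OF T, symmetric])
  finally show ?thesis .
qed

lemma L2_density_vanishing:
  fixes X :: "nat \<Rightarrow> 'a set"
  assumes "finite_measure M" and L2: "has_L2_density M \<nu>"
    and X: "range X \<subseteq> sets M" "decseq X"
    and le: "\<And>i. emeasure M (X i) \<le> ennreal (c * (r i)\<^sup>2)" and ge: "\<And>i. ennreal (r i) \<le> emeasure \<nu> (X i)"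
    and r: "\<And>i. r i > 0" "r \<longlonglongrightarrow> 0" and c: "c > 0"
  shows False
proof -
  interpret finite_measure M by fact
  define h where "h = RN_deriv M \<nu>"
  have [measurable]: "h \<in> borel_measurable M" by (simp add: h_def)
  have dens: "density M h = \<nu>"
    using L2 unfolding h_def has_L2_density_def by (intro density_RN_deriv) auto
  have Xm [measurable]: "X i \<in> sets M" for i using X by auto
  define D where "D = density M (\<lambda>x. (h x)\<^sup>2)"
  have D: "emeasure D A = (\<integral>\<^sup>+x. (h x)\<^sup>2 * indicator A x \<partial>M)" if "A \<in> sets M" for A
    using that by (simp add: D_def emeasure_density)
  have Dfin: "emeasure D (X i) \<noteq> \<infinity>" for i
  proof -
    have "emeasure D (X i) \<le> (\<integral>\<^sup>+x. (h x)\<^sup>2 \<partial>M)"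
      unfolding D[OF Xm] by (intro nn_integral_mono) (auto split: split_indicator)
    also have "\<dots> < \<infinity>" using L2 by (simp add: has_L2_density_def h_def)
    finally show ?thesis by simp
  qed
  have lower: "ennreal (1 / c) \<le> emeasure D (X i)" for i
  proof -
    have "ennreal (r i) \<le> (\<integral>\<^sup>+x. (h x * indicator (X i) x) * indicator (X i) x \<partial>M)"
    proof -
      have "emeasure \<nu> (X i) = (\<integral>\<^sup>+x. h x * indicator (X i) x \<partial>M)"
        unfolding dens[symmetric] by (rule emeasure_density) auto
      also have "\<dots> = (\<integral>\<^sup>+x. (h x * indicator (X i) x) * indicator (X i) x \<partial>M)"
        by (intro nn_integral_cong) (auto split: split_indicator)
      finally show ?thesis using ge[of i] by simp
    qed
    then have "(ennreal (r i))\<^sup>2 \<le> (\<integral>\<^sup>+x. (h x * indicator (X i) x) * indicator (X i) x \<partial>M)\<^sup>2"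
      by (rule power_mono) simp
    also have "\<dots> \<le> (\<integral>\<^sup>+x. (h x * indicator (X i) x)\<^sup>2 \<partial>M) * (\<integral>\<^sup>+x. (indicator (X i) x)\<^sup>2 \<partial>M)"
      by (rule Cauchy_Schwarz_nn_integral) auto
    also have "(\<integral>\<^sup>+x. (h x * indicator (X i) x)\<^sup>2 \<partial>M) = emeasure D (X i)"
      unfolding D[OF Xm] by (intro nn_integral_cong) (auto split: split_indicator)
    also have "(\<integral>\<^sup>+x. (indicator (X i) x)\<^sup>2 \<partial>M) = (\<integral>\<^sup>+x. indicator (X i) x \<partial>M)"
      by (intro nn_integral_cong) (auto split: split_indicator)
    also have "\<dots> = emeasure M (X i)" by simp
    also have "emeasure D (X i) * \<dots> \<le> emeasure D (X i) * ennreal (c * (r i)\<^sup>2)"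
      by (intro mult_left_mono le) simp
    finally have *: "(ennreal (r i))\<^sup>2 \<le> emeasure D (X i) * ennreal (c * (r i)\<^sup>2)" .
    obtain d where d: "emeasure D (X i) = ennreal d" "d \<ge> 0"
      using Dfin[of i] by (cases "emeasure D (X i)") auto
    have "(r i)\<^sup>2 \<le> d * (c * (r i)\<^sup>2)"
      using * d r(1)[of i] c by (simp add: ennreal_power flip: ennreal_mult)
    then have "1 \<le> d * c" using r(1)[of i] by simp
    then show ?thesis using d c by (simp add: field_simps ennreal_leI)
  qed
  have "emeasure M (\<Inter>i. X i) = 0"
  proof -
    have "emeasure M (\<Inter>i. X i) \<le> ennreal (c * (r i)\<^sup>2)" for i
      using emeasure_mono[OF INF_lower[of i UNIV X] Xm] le[of i] by simp
    moreover have "(\<lambda>i. ennreal (c * (r i)\<^sup>2)) \<longlonglongrightarrow> ennreal (c * 0\<^sup>2)"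
      by (intro tendsto_intros r)
    ultimately have "emeasure M (\<Inter>i. X i) \<le> ennreal (c * 0\<^sup>2)"
      by (intro LIMSEQ_le_const) auto
    then show ?thesis by simp
  qed
  then have "(\<Inter>i. X i) \<in> null_sets M" by (intro null_setsI) auto
  then have "(\<Inter>i. X i) \<in> null_sets D"
    unfolding D_def by (intro subsetD[OF absolutely_continuousI_density[unfolded absolutely_continuous_def]]) auto
  then have "(\<lambda>i. emeasure D (X i)) \<longlonglongrightarrow> 0"
    using Lim_emeasure_decseq[of X D] X Dfin by (simp add: D_def null_setsD1)
  then have "ennreal (1 / c) \<le> 0"
    using lower by (intro LIMSEQ_le_const) auto
  then show False using c by (simp add: ennreal_eq_0_iff)
qed

theorem theorem4p2:
  fixes mG mK :: "(complex^2^2) measure" and z1 z2 :: "complex^2^2"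
  assumes "normalized_haar SU mG" and "normalized_haar SO mK"
    and "z1 \<in> SU" and "z2 \<in> SU"
  shows "\<not> has_L2_density mG (mult_convolution (orbital_measure mK z1) (orbital_measure mK z2))"
proof
  assume L2: "has_L2_density mG (mult_convolution (orbital_measure mK z1) (orbital_measure mK z2))"
  interpret prob_space mG using assms(1) by (simp add: normalized_haar_def)
  define b where "b = (cmod (SO_part z1) * cmod (SO_part z2) + cmod (SO_perp z1) * cmod (SO_perp z2))\<^sup>2"
  define X where "X i = {g \<in> SU. \<bar>(cmod (SO_part g))\<^sup>2 - b\<bar> \<le> 16 / (real (Suc i))\<^sup>2}" for i
  have [measurable]: "(\<lambda>g. (cmod (SO_part g))\<^sup>2) \<in> borel_measurable mG"
    by (rule measurable_restrict_borel_continuous[of _ SU])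
      (use assms(1) in \<open>auto simp: normalized_haar_def intro!: continuous_intros\<close>)
  have "X i = {g \<in> space mG. \<bar>(cmod (SO_part g))\<^sup>2 - b\<bar> \<le> 16 / (real (Suc i))\<^sup>2}" for i
    by (simp add: X_def space_normalized_haar[OF assms(1)])
  then have sets: "range X \<subseteq> sets mG" by auto
  have dec: "decseq X"
  proof (rule decseq_SucI)
    fix i
    have "16 / (real (Suc (Suc i)))\<^sup>2 \<le> 16 / (real (Suc i))\<^sup>2"
      by (intro divide_left_mono power_mono) auto
    then show "X (Suc i) \<subseteq> X i" unfolding X_def by auto
  qed
  show False
  proof (rule L2_density_vanishing[OF finite_measure_axioms L2 sets dec])
    fix i
    show "emeasure mG (X i) \<le> ennreal (50 * (1 / real (Suc i))\<^sup>2)"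
      using haar_band[OF assms(1), of "Suc i" b]
      by (simp add: X_def emeasure_eq_measure power_divide ennreal_leI)
    show "ennreal (1 / real (Suc i)) \<le> emeasure (mult_convolution (orbital_measure mK z1) (orbital_measure mK z2)) (X i)"
      unfolding X_def b_def by (rule orbital_convolution_near_max[OF assms(2-4)]) simp
  next
    show "(\<lambda>i. 1 / real (Suc i)) \<longlonglongrightarrow> 0" by (rule LIMSEQ_Suc[OF lim_1_over_n])
  qed auto
qed

end
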